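(* Assume that the radius distribution $f(r)=\mathbb{P}(R\ge r)$ is a slowly varying function. Then $f(n)T_n\Longrightarrow\mathrm{Exp}(1)$ in distribution as $n\to\infty$, where $\mathbb{P}(\mathrm{Exp}(1)<t)=1-e^{-t}$.
   Context: Covering process: $R$ takes values in $\{1,2,\dots\}$, $f(r)=\mathbb{P}(R\ge r)$ for real $r\ge1$. On $\mathbb{Z}/n\mathbb{Z}$, let $(R_k)$ be i.i.d. copies of $R$, $(U_k)$ i.i.d. uniform on $\mathbb{Z}/n\mathbb{Z}$, independent; $\mathcal{O}_k=\{U_k,\dots,U_k+R_k-1\}$ (mod $n$), $C_0=\emptyset$, $C_k=C_{k-1}\cup\mathcal{O}_k$; with an independent rate-one Poisson process $N(t)$, $X_t=C_{N(t)}$ and $T_n=\inf\{t:X_t=\mathbb{Z}/n\mathbb{Z}\}$. A measurable $U:\mathbb{R}_+\to\mathbb{R}_+$ is regularly varying with index $p$ ($U\in\mathrm{RV}_p$) if $\lim_{x\to\infty}U(xt)/U(x)=t^p$ for all $t>0$; slowly varying means $\mathrm{RV}_0$. *)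

theory Defs
  imports "HOL-Probability.Probability"
begin

definition regularly_varying :: "real \<Rightarrow> (real \<Rightarrow> real) \<Rightarrow> bool" where
  "regularly_varying p U \<longleftrightarrow>
     U \<in> borel_measurable borel \<and> (\<forall>x\<ge>0. 0 \<le> U x) \<and>
     (\<forall>t>0. ((\<lambda>x. U (x * t) / U x) \<longlongrightarrow> t powr p) at_top)"

definition slowly_varying :: "(real \<Rightarrow> real) \<Rightarrow> bool" where
  "slowly_varying U \<longleftrightarrow> regularly_varying 0 U"

definition radius_tail :: "nat pmf \<Rightarrow> real \<Rightarrow> real" where
  "radius_tail Rd r = measure_pmf.prob Rd {k. r \<le> real k}"

text \<open>Z/nZ is represented by {0..<n}; the arc {u, ..., u+r-1} mod n.\<close>
definition arc :: "nat \<Rightarrow> nat \<Rightarrow> nat \<Rightarrow> nat set" where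
  "arc n u r = {(u + i) mod n | i. i < r}"

text \<open>C_k = O_1 \<union> ... \<union> O_k, where the k-th arc uses the (k-1)-th (0-indexed) variables.\<close>
definition covered_set :: "nat \<Rightarrow> (nat \<Rightarrow> 'a \<Rightarrow> nat) \<Rightarrow> (nat \<Rightarrow> 'a \<Rightarrow> nat) \<Rightarrow> nat \<Rightarrow> 'a \<Rightarrow> nat set" where
  "covered_set n R U k \<omega> = (\<Union>j<k. arc n (U j \<omega>) (R j \<omega>))"

text \<open>Rate-one Poisson process built from i.i.d. Exp(1) interarrival times E_0, E_1, ...:
  N(t) = number of k >= 1 with E_0 + ... + E_(k-1) <= t.\<close>
definition poisson_count :: "(nat \<Rightarrow> 'a \<Rightarrow> real) \<Rightarrow> real \<Rightarrow> 'a \<Rightarrow> nat" where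
  "poisson_count E t \<omega> = card {k. 1 \<le> k \<and> (\<Sum>j<k. E j \<omega>) \<le> t}"

definition cover_time :: "nat \<Rightarrow> (nat \<Rightarrow> 'a \<Rightarrow> nat) \<Rightarrow> (nat \<Rightarrow> 'a \<Rightarrow> nat) \<Rightarrow> (nat \<Rightarrow> 'a \<Rightarrow> real) \<Rightarrow> 'a \<Rightarrow> real" where
  "cover_time n R U E \<omega> =
     Inf {t. 0 \<le> t \<and> covered_set n R U (poisson_count E t \<omega>) \<omega> = {0..<n}}"

text \<open>All the driving variables as one real-valued family, for stating mutual independence.\<close>
definition driving_family :: "(nat \<Rightarrow> 'a \<Rightarrow> nat) \<Rightarrow> (nat \<Rightarrow> 'a \<Rightarrow> nat) \<Rightarrow> (nat \<Rightarrow> 'a \<Rightarrow> real)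
    \<Rightarrow> nat + nat + nat \<Rightarrow> 'a \<Rightarrow> real" where
  "driving_family R U E i = (case i of
      Inl k \<Rightarrow> (\<lambda>\<omega>. real (R k \<omega>))
    | Inr (Inl k) \<Rightarrow> (\<lambda>\<omega>. real (U k \<omega>))
    | Inr (Inr k) \<Rightarrow> E k)"

end

theory Submission
  imports Defs
begin

text \<open>
  Let \<open>f\<close> be the tail of the radius and \<open>Q = (f 1 + \<dots> + f n) / n\<close>, the probability that one arc
  contains the point \<open>0\<close>. The circle is covered as soon as some arc has length at least \<open>n\<close>, and is
  not covered as long as \<open>0\<close> is uncovered. By Poisson thinning these two events occur at
  exponential times of rates \<open>f n\<close> and \<open>Q\<close>, so
  \<open>1 - exp (- s f n) \<le> P(T \<le> s) \<le> 1 - exp (- s Q)\<close>. Karamata's theorem for a monotone slowly varying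
  \<open>f\<close> gives \<open>Q / f n \<longlonglongrightarrow> 1\<close>, and both bounds at \<open>s = x / f n\<close> tend to \<open>1 - exp (- x)\<close>.
\<close>

subsection \<open>Karamata's theorem for monotone slowly varying functions\<close>

lemma radius_tail_antimono: "x \<le> y \<Longrightarrow> radius_tail Rd y \<le> radius_tail Rd x"
  unfolding radius_tail_def by (intro measure_pmf.finite_measure_mono) auto

lemma radius_tail_nonneg: "0 \<le> radius_tail Rd x"
  unfolding radius_tail_def by simp

lemma slowly_varying_tendsto:
  assumes "slowly_varying f" "0 < t"
  shows "((\<lambda>x. f (x * t) / f x) \<longlongrightarrow> 1) at_top"
  using assms unfolding slowly_varying_def regularly_varying_def
  by (metis powr_zero_eq_one less_numeral_extra(3))

text \<open>Division by zero yields 0, so a ratio tending to 1 forces \<open>f\<close> to be nonzero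
  at arbitrarily large arguments. Monotonicity carries positivity back to every
  \<open>x\<close>.\<close>

lemma slowly_varying_antimono_pos:
  fixes f :: "real \<Rightarrow> real"
  assumes sv: "slowly_varying f" and nonneg: "\<And>x. 0 \<le> f x"
    and anti: "\<And>x y. x \<le> y \<Longrightarrow> f y \<le> f x"
  shows "0 < f x"
proof -
  have "((\<lambda>x. f (x * 1) / f x) \<longlongrightarrow> 1) at_top"
    by (rule slowly_varying_tendsto[OF sv]) simp
  then have "eventually (\<lambda>x. f (x * 1) / f x > 1/2) at_top"
    by (rule order_tendstoD) simp
  then have "eventually (\<lambda>y. f y \<noteq> 0 \<and> y \<ge> x) at_top"
    using eventually_ge_at_top[of x] by eventually_elim auto
  then obtain y where "f y \<noteq> 0" "y \<ge> x"
    by (auto simp: eventually_at_top_linorder)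
  then show ?thesis
    using nonneg[of y] anti[of x y] by linarith
qed

lemma slowly_varying_half_le:
  fixes f :: "real \<Rightarrow> real"
  assumes sv: "slowly_varying f" and nonneg: "\<And>x. 0 \<le> f x"
    and anti: "\<And>x y. x \<le> y \<Longrightarrow> f y \<le> f x" and "0 < \<eta>"
  shows "eventually (\<lambda>n. f (real (n div 2)) \<le> (1 + \<eta>) * f (real n)) sequentially"
proof -
  \<comment> \<open>The scale 1/3 absorbs the rounding in \<open>n div 2\<close>, which may fall
    below n/2 but is at least n/3 once n is at least 3.\<close>
  have "((\<lambda>x. f (x * (1/3)) / f x) \<longlongrightarrow> 1) at_top"
    by (rule slowly_varying_tendsto[OF sv]) simp
  then have "eventually (\<lambda>x. f (x * (1/3)) / f x < 1 + \<eta>) at_top"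
    by (rule order_tendstoD) (use \<open>0 < \<eta>\<close> in simp)
  then have "eventually (\<lambda>n. f (real n * (1/3)) / f (real n) < 1 + \<eta>) sequentially"
    by (rule eventually_compose_filterlim) (rule filterlim_real_sequentially)
  then show ?thesis
    using eventually_ge_at_top[of 3]
  proof eventually_elim
    case (elim n)
    have "real n * (1/3) \<le> real (n div 2)"
      using elim(2) by linarith
    then have "f (real (n div 2)) \<le> f (real n * (1/3))"
      by (rule anti)
    also have "\<dots> \<le> (1 + \<eta>) * f (real n)"
      using elim(1) slowly_varying_antimono_pos[OF sv nonneg anti, of "real n"]
      by (simp add: divide_less_eq)
    finally show ?case .
  qed
qed

lemma slowly_varying_times_id_at_top:
  fixes f :: "real \<Rightarrow> real"
  assumes sv: "slowly_varying f" and nonneg: "\<And>x. 0 \<le> f x"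
    and anti: "\<And>x y. x \<le> y \<Longrightarrow> f y \<le> f x"
  shows "filterlim (\<lambda>n. real n * f (real n)) at_top sequentially"
proof -
  obtain N where N: "\<And>n. n \<ge> N \<Longrightarrow> f (real (n div 2)) \<le> (1 + 1/3) * f (real n)"
    using slowly_varying_half_le[OF sv nonneg anti, of "1/3"]
    by (auto simp: eventually_sequentially)
  \<comment> \<open>This value bounds \<open>f\<close> from below on the base range up to
    \<open>N + 2\<close>. Beyond that range \<open>n div 2\<close> is at least 1, so the induction
    hypothesis applies to it.\<close>
  define c where "c = f (real (N + 2))"
  have "0 < c"
    unfolding c_def by (rule slowly_varying_antimono_pos[OF sv nonneg anti])
  \<comment> \<open>\<open>\<surd>n f(n)\<close> stays bounded below: doubling \<open>n\<close> costs \<open>f\<close> at most a factor \<open>4/3 < \<surd>2\<close>.\<close>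
  have *: "c\<^sup>2 \<le> real n * (f (real n))\<^sup>2" if "1 \<le> n" for n
    using that
  proof (induction n rule: less_induct)
    case (less n)
    show ?case
    proof (cases "n \<le> N + 2")
      case True
      then have "c \<le> f (real n)"
        unfolding c_def by (intro anti) simp
      then have "c\<^sup>2 \<le> (f (real n))\<^sup>2"
        using \<open>0 < c\<close> by (intro power_mono) auto
      also have "\<dots> \<le> real n * (f (real n))\<^sup>2"
        using less.prems by (simp add: mult_le_cancel_right1)
      finally show ?thesis .
    next
      case False
      then have "c\<^sup>2 \<le> real (n div 2) * (f (real (n div 2)))\<^sup>2"
        by (intro less.IH) auto
      also have "\<dots> \<le> real (n div 2) * ((1 + 1/3) * f (real n))\<^sup>2"
        using False N[of n] by (intro mult_left_mono power_mono nonneg) auto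
      also have "\<dots> = (16/9 * real (n div 2)) * (f (real n))\<^sup>2"
        by (simp add: power2_eq_square)
      also have "\<dots> \<le> real n * (f (real n))\<^sup>2"
        by (intro mult_right_mono) (linarith, simp)
      finally show ?thesis .
    qed
  qed
  have "filterlim (\<lambda>n. c * sqrt (real n)) at_top sequentially"
    using \<open>0 < c\<close>
    by (intro filterlim_tendsto_pos_mult_at_top[OF tendsto_const]
        filterlim_compose[OF sqrt_at_top] filterlim_real_sequentially) auto
  moreover have "eventually (\<lambda>n. c * sqrt (real n) \<le> real n * f (real n)) sequentially"
    using eventually_ge_at_top[of 1]
  proof eventually_elim
    case (elim n)
    have "(c * sqrt (real n))\<^sup>2 = real n * c\<^sup>2"
      by (simp add: power_mult_distrib)
    also have "\<dots> \<le> real n * (real n * (f (real n))\<^sup>2)"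
      using *[OF elim] by (intro mult_left_mono) auto
    also have "\<dots> = (real n * f (real n))\<^sup>2"
      by (simp add: power2_eq_square)
    finally show ?case
      by (rule power2_le_imp_le) (simp add: nonneg)
  qed
  ultimately show ?thesis
    by (rule filterlim_at_top_mono)
qed

text \<open>Each summand is at least the last one, so the ratio is at least 1. The work lies in the
  upper bound.\<close>

lemma Karamata_antimono:
  fixes f :: "real \<Rightarrow> real"
  assumes sv: "slowly_varying f" and nonneg: "\<And>x. 0 \<le> f x"
    and anti: "\<And>x y. x \<le> y \<Longrightarrow> f y \<le> f x"
  shows "(\<lambda>n. (\<Sum>r=1..n. f (real r)) / (real n * f (real n))) \<longlonglongrightarrow> 1"
proof -
  define S where "S n = (\<Sum>r=1..n. f (real r))" for n :: nat
  have pos: "0 < f x" for x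
    by (rule slowly_varying_antimono_pos[OF sv nonneg anti])
  have mono_S: "S m \<le> S n" if "m \<le> n" for m n
    unfolding S_def using that by (intro sum_mono2) (auto simp: nonneg)
  have split: "S n \<le> S m + real (n - m) * f (real m)" if "m \<le> n" for m n
  proof -
    have "S n = S m + (\<Sum>r=m+1..n. f (real r))"
      unfolding S_def using that sum.ub_add_nat[of 1 m "\<lambda>r. f (real r)" "n - m"] by simp
    also have "(\<Sum>r=m+1..n. f (real r)) \<le> (\<Sum>r=m+1..n. f (real m))"
      by (intro sum_mono anti) auto
    finally show ?thesis by simp
  qed
  have lower: "real n * f (real n) \<le> S n" for n
  proof -
    have "(\<Sum>r=1..n. f (real n)) \<le> S n"
      unfolding S_def by (intro sum_mono anti) auto
    then show ?thesis by simp
  qed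
  \<comment> \<open>Induction along \<open>S n \<le> S (n div 2) + (n - n div 2) f (n div 2)\<close>; the additive constant absorbs
    small \<open>n\<close> and is negligible because \<open>n f(n)\<close> tends to infinity.\<close>
  have upper: "\<exists>K. \<forall>n. S n \<le> (1 + \<delta>) * (real n * f (real n)) + K" if "0 < \<delta>" for \<delta>
  proof -
    \<comment> \<open>Solves (1 + \<eta>)(1 + \<delta>/2) = 1 + \<delta>: the first factor pays for
      replacing \<open>f (n div 2)\<close> by \<open>f n\<close>, the second is what the induction
      hypothesis at half of \<open>n\<close> leaves.\<close>
    define \<eta> where "\<eta> = \<delta> / (2 + \<delta>)"
    have \<eta>: "0 < \<eta>" "(1 + \<eta>) * (1 + \<delta>/2) = 1 + \<delta>"
      using that by (auto simp: \<eta>_def field_simps)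
    obtain N where N: "\<And>n. n \<ge> N \<Longrightarrow> f (real (n div 2)) \<le> (1 + \<eta>) * f (real n)"
      using slowly_varying_half_le[OF sv nonneg anti \<eta>(1)]
      by (auto simp: eventually_sequentially)
    have "S n \<le> (1 + \<delta>) * (real n * f (real n)) + S (N + 1)" for n
    proof (induction n rule: less_induct)
      case (less n)
      show ?case
      proof (cases "n \<le> N + 1")
        case True
        then show ?thesis
          using mono_S[of n "N + 1"] that nonneg[of "real n"]
          by (auto intro!: add_increasing)
      next
        case False
        define m where "m = n div 2"
        have m: "m < n" "2 * real m \<le> real n"
          using False by (auto simp: m_def)
        have "S n \<le> S m + real (n - m) * f (real m)"
          using m by (intro split) auto
        also have "\<dots> \<le> (1 + \<delta>) * (real m * f (real m)) + S (N + 1) + real (n - m) * f (real m)"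
          using less.IH[OF m(1)] by simp
        also have "\<dots> = (real n + \<delta> * real m) * f (real m) + S (N + 1)"
          using m(1) by (simp add: algebra_simps of_nat_diff)
        also have "(real n + \<delta> * real m) * f (real m) \<le> (real n * (1 + \<delta>/2)) * f (real m)"
        proof (intro mult_right_mono nonneg)
          have "\<delta> * (2 * real m) \<le> \<delta> * real n"
            using m that by (intro mult_left_mono) auto
          then show "real n + \<delta> * real m \<le> real n * (1 + \<delta>/2)"
            by (simp add: algebra_simps)
        qed
        also have "\<dots> \<le> (real n * (1 + \<delta>/2)) * ((1 + \<eta>) * f (real n))"
          using N[of n] False that unfolding m_def by (intro mult_left_mono) auto
        also have "\<dots> = ((1 + \<eta>) * (1 + \<delta>/2)) * (real n * f (real n))"
          by (simp add: mult_ac)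
        finally show ?thesis
          unfolding \<eta>(2) by simp
      qed
    qed
    then show ?thesis by blast
  qed
  show ?thesis
    unfolding S_def[symmetric]
  proof (rule order_tendstoI)
    fix a :: real assume "a < 1"
    show "eventually (\<lambda>n. a < S n / (real n * f (real n))) sequentially"
      using eventually_gt_at_top[of 0]
    proof eventually_elim
      case (elim n)
      then have "1 \<le> S n / (real n * f (real n))"
        using lower[of n] pos[of "real n"] by (simp add: le_divide_eq)
      with \<open>a < 1\<close> show ?case by simp
    qed
  next
    fix a :: real assume "1 < a"
    \<comment> \<open>One \<delta> is spent on the factor in \<open>upper\<close>, the other on
      absorbing \<open>K\<close>.\<close>
    define \<delta> where "\<delta> = (a - 1) / 2"
    have \<delta>: "0 < \<delta>" "1 + 2 * \<delta> = a"
      using \<open>1 < a\<close> by (auto simp: \<delta>_def field_simps)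
    from upper[OF \<delta>(1)] obtain K where K: "\<And>n. S n \<le> (1 + \<delta>) * (real n * f (real n)) + K"
      by blast
    have "eventually (\<lambda>n. real n * f (real n) > \<bar>K\<bar> / \<delta>) sequentially"
      using slowly_varying_times_id_at_top[OF sv nonneg anti]
      by (auto simp: filterlim_at_top_dense)
    then show "eventually (\<lambda>n. S n / (real n * f (real n)) < a) sequentially"
      using eventually_gt_at_top[of 0]
    proof eventually_elim
      case (elim n)
      have p: "0 < real n * f (real n)"
        using elim(2) pos by simp
      have "K < \<delta> * (real n * f (real n))"
        using elim(1) \<delta>(1) by (simp add: divide_less_eq mult.commute)
      then have "S n < (1 + 2 * \<delta>) * (real n * f (real n))"
        using K[of n] by (simp add: algebra_simps)
      then show ?case
        using p \<delta>(2) by (simp add: divide_less_eq)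
    qed
  qed
qed

subsection \<open>Arrival times, arcs and measurability\<close>

definition arrival :: "(nat \<Rightarrow> 'a \<Rightarrow> real) \<Rightarrow> nat \<Rightarrow> 'a \<Rightarrow> real" where
  "arrival E k \<omega> = (\<Sum>j<k. E j \<omega>)"

lemma poisson_count_arrival: "poisson_count E t \<omega> = card {k. 1 \<le> k \<and> arrival E k \<omega> \<le> t}"
  unfolding poisson_count_def arrival_def ..

lemma arrival_mono: "(\<And>j. 0 \<le> E j \<omega>) \<Longrightarrow> k \<le> l \<Longrightarrow> arrival E k \<omega> \<le> arrival E l \<omega>"
  unfolding arrival_def by (intro sum_mono2) auto

lemma arrival_measurable [measurable]:
  "(\<And>j. E j \<in> borel_measurable M) \<Longrightarrow> arrival E k \<in> borel_measurable M"
  unfolding arrival_def by (intro borel_measurable_sum) auto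

lemma poisson_count_eq:
  assumes nonneg: "\<And>j. 0 \<le> E j \<omega>"
    and s: "arrival E k \<omega> \<le> s" "s < arrival E (Suc k) \<omega>"
  shows "poisson_count E s \<omega> = k"
proof -
  have "{l. 1 \<le> l \<and> arrival E l \<omega> \<le> s} = {1..k}"
  proof safe
    fix l assume "1 \<le> l" "arrival E l \<omega> \<le> s"
    with s(2) have "\<not> Suc k \<le> l"
      using arrival_mono[of E \<omega> "Suc k" l] nonneg by force
    with \<open>1 \<le> l\<close> show "l \<in> {1..k}" by auto
  next
    fix l assume "l \<in> {1..k}"
    then show "arrival E l \<omega> \<le> s"
      using arrival_mono[of E \<omega> l k] nonneg s(1) by auto
  qed auto
  then show ?thesis
    by (simp add: poisson_count_arrival)
qed

lemma poisson_count_le: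
  assumes nonneg: "\<And>j. 0 \<le> E j \<omega>" and t: "t < arrival E (Suc k) \<omega>"
  shows "poisson_count E t \<omega> \<le> k"
proof -
  have "{l. 1 \<le> l \<and> arrival E l \<omega> \<le> t} \<subseteq> {1..k}"
  proof
    fix l assume l: "l \<in> {l. 1 \<le> l \<and> arrival E l \<omega> \<le> t}"
    with t have "\<not> Suc k \<le> l"
      using arrival_mono[of E \<omega> "Suc k" l] nonneg by force
    with l show "l \<in> {1..k}" by auto
  qed
  then have "card {l. 1 \<le> l \<and> arrival E l \<omega> \<le> t} \<le> card {1..k}"
    by (intro card_mono) auto
  then show ?thesis
    by (simp add: poisson_count_arrival)
qed

section \<open>Arcs and covered sets\<close>

lemma covered_set_mono: "k \<le> l \<Longrightarrow> covered_set n R U k \<omega> \<subseteq> covered_set n R U l \<omega>"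
  unfolding covered_set_def by (intro UN_mono) auto

lemma covered_set_subset: "1 \<le> n \<Longrightarrow> covered_set n R U k \<omega> \<subseteq> {0..<n}"
  unfolding covered_set_def arc_def by auto

lemma covered_set_full_mono:
  assumes "1 \<le> n" "k \<le> l" "covered_set n R U k \<omega> = {0..<n}"
  shows "covered_set n R U l \<omega> = {0..<n}"
  using covered_set_mono[OF assms(2), of n R U \<omega>] covered_set_subset[OF assms(1), of R U l \<omega>] assms(3)
  by auto

lemma arc_full:
  assumes "1 \<le> n" "n \<le> r"
  shows "arc n u r = {0..<n}"
proof
  show "arc n u r \<subseteq> {0..<n}"
    using assms by (auto simp: arc_def)
  show "{0..<n} \<subseteq> arc n u r"
  proof
    fix x assume "x \<in> {0..<n}"
    \<comment> \<open>The forward distance from \<open>u\<close> to \<open>x\<close> modulo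
      \<open>n\<close>, written so that natural subtraction never truncates.\<close>
    define i where "i = (x + (n - u mod n)) mod n"
    have "u mod n < n" using assms by simp
    have "(u + i) mod n = (u mod n + (x + (n - u mod n))) mod n"
      unfolding i_def by (simp add: mod_simps)
    also have "\<dots> = (x + n) mod n"
      using \<open>u mod n < n\<close> by (intro arg_cong[where f="\<lambda>x. x mod n"]) simp
    also have "\<dots> = x"
      using \<open>x \<in> {0..<n}\<close> by simp
    finally have "(u + i) mod n = x" .
    moreover have "i < n" using assms by (simp add: i_def)
    ultimately show "x \<in> arc n u r"
      using assms by (auto simp: arc_def intro!: exI[of _ i])
  qed
qed

text \<open>Starting at \<open>u\<close>, an arc reaches 0 after n - u steps. The outer
  \<open>mod\<close> handles u = 0, where length 1 is enough.\<close>

lemma zero_in_arcD: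
  assumes "u < n" "0 \<in> arc n u r"
  shows "(n - u) mod n + 1 \<le> r"
proof (cases "u = 0")
  case True
  with assms show ?thesis by (auto simp: arc_def)
next
  case False
  from assms(2) obtain i where i: "n dvd u + i" "i < r"
    by (auto simp: arc_def)
  then have "n \<le> u + i"
    using False by (auto intro: dvd_imp_le)
  then show ?thesis
    using i(2) False assms(1) by simp
qed

text \<open>For any \<^term>\<open>t\<close> at which the circle is covered, the count does not change when
  \<^term>\<open>t\<close> is lowered to the last arrival before it; so only arrival times matter, whatever
  the signs of the interarrival times.\<close>
lemma covered_at_arrival:
  assumes "1 \<le> n" "0 \<le> t" "covered_set n R U (poisson_count E t \<omega>) \<omega> = {0..<n}"
  shows "\<exists>i. max 0 (arrival E i \<omega>) \<le> t \<and>
    covered_set n R U (poisson_count E (max 0 (arrival E i \<omega>)) \<omega>) \<omega> = {0..<n}"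
proof -
  define A where "A = {k. 1 \<le> k \<and> arrival E k \<omega> \<le> t}"
  have "poisson_count E t \<omega> \<noteq> 0"
    using assms by (intro notI) (auto simp: covered_set_def)
  \<comment> \<open>Infinite sets have cardinality 0, so this gives finiteness of \<open>A\<close>
    as well as nonemptiness.\<close>
  then have "card A \<noteq> 0"
    by (simp add: poisson_count_arrival A_def)
  then have "finite A" "A \<noteq> {}"
    by (auto dest: card_ge_0_finite)
  define m where "m = Max ((\<lambda>k. arrival E k \<omega>) ` A)"
  have "m \<in> (\<lambda>k. arrival E k \<omega>) ` A"
    unfolding m_def using \<open>finite A\<close> \<open>A \<noteq> {}\<close> by (intro Max_in) auto
  then obtain i where i: "i \<in> A" "m = arrival E i \<omega>" by auto
  have "arrival E k \<omega> \<le> m" if "k \<in> A" for k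
    unfolding m_def using \<open>finite A\<close> that by (intro Max_ge) auto
  then have "{k. 1 \<le> k \<and> arrival E k \<omega> \<le> max 0 m} = A"
    using i assms(2) by (fastforce simp: A_def)
  then have "poisson_count E (max 0 m) \<omega> = poisson_count E t \<omega>"
    by (simp add: poisson_count_arrival A_def)
  moreover have "max 0 m \<le> t"
    using i assms(2) by (simp add: A_def)
  ultimately show ?thesis
    using assms(3) i(2) by (intro exI[of _ i]) simp
qed

text \<open>Reduces an infimum over uncountably many times to countably many arrival times, as
  measurability requires. \<open>Inf {}\<close> is the default value when the circle is never
  covered.\<close>

lemma cover_time_less_iff:
  fixes E :: "nat \<Rightarrow> 'a \<Rightarrow> real" and R U :: "nat \<Rightarrow> 'a \<Rightarrow> nat"
  assumes "1 \<le> n"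
  defines "tm \<equiv> \<lambda>i \<omega>. max 0 (arrival E i \<omega>)"
  defines "cov \<equiv> \<lambda>i \<omega>. covered_set n R U (poisson_count E (tm i \<omega>) \<omega>) \<omega> = {0..<n}"
  shows "cover_time n R U E \<omega> < a \<longleftrightarrow>
    (if \<exists>i. cov i \<omega> then \<exists>i. tm i \<omega> < a \<and> cov i \<omega> else Inf {} < a)"
proof -
  define B where "B = {t. 0 \<le> t \<and> covered_set n R U (poisson_count E t \<omega>) \<omega> = {0..<n}}"
  have cov: "\<exists>i. tm i \<omega> \<le> t \<and> cov i \<omega>" if "t \<in> B" for t
    using covered_at_arrival[OF assms(1), of t R U E \<omega>] that unfolding B_def tm_def cov_def by simp
  have mem: "tm i \<omega> \<in> B" if "cov i \<omega>" for i
    using that by (simp add: B_def cov_def tm_def)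
  have "cover_time n R U E \<omega> = Inf B"
    unfolding cover_time_def B_def ..
  moreover have "Inf B < a \<longleftrightarrow> (\<exists>i. tm i \<omega> < a \<and> cov i \<omega>)" if "B \<noteq> {}"
  proof -
    have "bdd_below B" by (rule bdd_belowI[of _ 0]) (simp add: B_def)
    from cInf_less_iff[OF that this, of a] show ?thesis
      using cov mem by (meson le_less_trans)
  qed
  ultimately show ?thesis
    using cov mem by (cases "B = {}") auto
qed

section \<open>Measurability of the cover time\<close>

lemma measurable_covered_set:
  assumes [measurable]: "\<And>k. R k \<in> measurable M (count_space UNIV)"
    "\<And>k. U k \<in> measurable M (count_space UNIV)"
  shows "Measurable.pred M (\<lambda>\<omega>. covered_set n R U k \<omega> = {0..<n})"
proof -
  \<comment> \<open>Naming the values of \<open>U j\<close> and \<open>R j\<close> by countable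
    quantifiers leaves only elementary events.\<close>
  have "covered_set n R U k \<omega> = {0..<n} \<longleftrightarrow>
      (\<forall>x. (\<exists>j<k. \<exists>u r. U j \<omega> = u \<and> R j \<omega> = r \<and> x \<in> arc n u r) \<longleftrightarrow> x < n)" for \<omega>
    by (auto simp: covered_set_def set_eq_iff)
  then show ?thesis
    by simp measurable
qed

lemma cover_time_measurable:
  assumes n: "1 \<le> n"
    and RU: "\<And>k. R k \<in> measurable M (count_space UNIV)"
      "\<And>k. U k \<in> measurable M (count_space UNIV)"
    and E [measurable]: "\<And>k. E k \<in> borel_measurable M"
  shows "cover_time n R U E \<in> borel_measurable M"
proof -
  define tm where "tm i \<omega> = max 0 (arrival E i \<omega>)" for i \<omega>
  have tm [measurable]: "tm i \<in> borel_measurable M" for i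
    unfolding tm_def by measurable
  have [measurable]: "(\<lambda>\<omega>. poisson_count E (tm i \<omega>) \<omega>) \<in> measurable M (count_space UNIV)" for i
    unfolding poisson_count_arrival by measurable
  note measurable_covered_set[OF RU, measurable]
  \<comment> \<open>The random number of arcs is likewise split into its countably many
    values.\<close>
  have cov: "covered_set n R U (poisson_count E (tm i \<omega>) \<omega>) \<omega> = {0..<n} \<longleftrightarrow>
      (\<exists>k. poisson_count E (tm i \<omega>) \<omega> = k \<and> covered_set n R U k \<omega> = {0..<n})" for i \<omega>
    by simp
  have "Measurable.pred M (\<lambda>\<omega>. cover_time n R U E \<omega> < a)" for a
    unfolding cover_time_less_iff[OF n] tm_def[symmetric] cov by measurable
  then show ?thesis
    by (auto simp: borel_measurable_iff_less pred_def)
qed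

subsection \<open>Bounds on the law of the cover time\<close>

lemma measurable_nat_if_real:
  assumes "(\<lambda>\<omega>. real (X \<omega>)) \<in> borel_measurable M"
  shows "X \<in> measurable M (count_space UNIV)"
proof -
  have "{\<omega> \<in> space M. X \<omega> = m} = {\<omega> \<in> space M. real (X \<omega>) = real m}" for m
    by simp
  moreover have "{\<omega> \<in> space M. real (X \<omega>) = real m} \<in> sets M" for m
    using assms by measurable
  ultimately show ?thesis
    by (simp add: measurable_count_space_eq2_countable vimage_def Int_def conj_commute)
qed

text \<open>Poisson thinning: if each of a Poisson(s) number of trials succeeds independently with
  probability \<open>p\<close>, this is the chance of at least one success. Used with p = f(n) and
  with p = Q.\<close>

lemma thinned_sums:
  fixes s p :: real
  shows "(\<lambda>k. s ^ k * exp (- s) / fact k * (1 - (1 - p) ^ k)) sums (1 - exp (- s * p))"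
proof -
  have "(\<lambda>k. (s ^ k /\<^sub>R fact k) * exp (- s) - ((s * (1 - p)) ^ k /\<^sub>R fact k) * exp (- s)) sums
      (exp s * exp (- s) - exp (s * (1 - p)) * exp (- s))"
    by (intro sums_diff sums_mult2 exp_converges)
  moreover have "(s ^ k /\<^sub>R fact k) * exp (- s) - ((s * (1 - p)) ^ k /\<^sub>R fact k) * exp (- s) =
      s ^ k * exp (- s) / fact k * (1 - (1 - p) ^ k)" for k
    unfolding power_mult_distrib by (simp add: divide_inverse algebra_simps)
  moreover have "exp s * exp (- s) - exp (s * (1 - p)) * exp (- s) = 1 - exp (- s * p)"
    by (simp add: algebra_simps flip: exp_add)
  ultimately show ?thesis
    by simp
qed

locale arc_covering = prob_space M for M :: "'a measure" +
  fixes n :: nat and Rd :: "nat pmf" and R U :: "nat \<Rightarrow> 'a \<Rightarrow> nat" and E :: "nat \<Rightarrow> 'a \<Rightarrow> real"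
  assumes n_pos: "1 \<le> n"
    and indep: "indep_vars (\<lambda>_. borel) (driving_family R U E) UNIV"
    and R_law: "\<And>k. distr M (count_space UNIV) (R k) = measure_pmf Rd"
    and U_law: "\<And>k. distr M (count_space UNIV) (U k) = measure_pmf (pmf_of_set {0..<n})"
    and E_law: "\<And>k. distributed M lborel (E k) (exponential_density 1)"
begin

lemma driving_measurable: "driving_family R U E i \<in> borel_measurable M"
  using indep by (auto simp: indep_vars_def)

lemma R_measurable [measurable]: "R k \<in> measurable M (count_space UNIV)"
  using driving_measurable[of "Inl k"] by (intro measurable_nat_if_real) (simp add: driving_family_def)

lemma U_measurable [measurable]: "U k \<in> measurable M (count_space UNIV)"
  using driving_measurable[of "Inr (Inl k)"] by (intro measurable_nat_if_real) (simp add: driving_family_def)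

lemma E_measurable [measurable]: "E k \<in> borel_measurable M"
  using driving_measurable[of "Inr (Inr k)"] by (simp add: driving_family_def)

lemma covered_measurable [measurable]:
  "Measurable.pred M (\<lambda>\<omega>. covered_set n R U k \<omega> = {0..<n})"
  by (intro measurable_covered_set) measurable

lemma prob_R: "prob {\<omega> \<in> space M. P (R k \<omega>)} = measure_pmf.prob Rd {r. P r}"
  unfolding R_law[of k, symmetric]
  by (subst measure_distr) (auto intro!: arg_cong[where f=prob])

lemma prob_U: "prob {\<omega> \<in> space M. P (U k \<omega>)} = measure_pmf.prob (pmf_of_set {0..<n}) {u. P u}"
  unfolding U_law[of k, symmetric]
  by (subst measure_distr) (auto intro!: arg_cong[where f=prob])

section \<open>Law of the Poisson clock\<close>

lemma AE_E_nonneg: "AE \<omega> in M. \<forall>j. 0 \<le> E j \<omega>"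
proof -
  have "AE \<omega> in M. 0 \<le> E j \<omega>" for j
    by (subst distributed_AE2[OF E_law]) (auto simp: erlang_density_def)
  then show ?thesis
    by (simp add: AE_all_countable)
qed

text \<open>A sum of \<open>k\<close> independent unit exponentials has an Erlang law with parameter
  k - 1; hence the separate case k = 0.\<close>

lemma prob_arrival_le:
  assumes "0 \<le> s"
  shows "prob {\<omega> \<in> space M. arrival E k \<omega> \<le> s} = 1 - (\<Sum>m<k. s ^ m * exp (- s) / fact m)"
proof (cases k)
  case 0
  with assms show ?thesis by (simp add: arrival_def prob_space)
next
  case (Suc l)
  let ?h = "\<lambda>j. Inr (Inr j) :: nat + nat + nat"
  have inj: "inj_on ?h A" for A by (auto simp: inj_on_def)
  have "distributed M lborel (\<lambda>\<omega>. \<Sum>i\<in>?h ` {..<k}. driving_family R U E i \<omega>)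
      (erlang_density (card (?h ` {..<k}) - 1) 1)"
  proof (rule exponential_distributed_sum)
    show "indep_vars (\<lambda>_. borel) (driving_family R U E) (?h ` {..<k})"
      by (rule indep_vars_subset[OF indep]) simp
  qed (use Suc E_law in \<open>auto simp: driving_family_def\<close>)
  also have "(\<lambda>\<omega>. \<Sum>i\<in>?h ` {..<k}. driving_family R U E i \<omega>) = arrival E k"
    by (simp add: fun_eq_iff arrival_def sum.reindex[OF inj] driving_family_def)
  also have "card (?h ` {..<k}) - 1 = l"
    using Suc by (simp add: card_image[OF inj])
  finally have "prob {\<omega> \<in> space M. arrival E k \<omega> \<le> s} = erlang_CDF l 1 s"
    using assms by (intro erlang_distributed_le) auto
  with assms Suc show ?thesis
    by (simp add: erlang_CDF_def lessThan_Suc_atMost)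
qed

text \<open>For nonnegative interarrival times this forces
  \<open>poisson_count E s \<omega> = k\<close>. Comparing two arrival times makes measurability and
  the Erlang law directly available.\<close>

definition clock_at :: "real \<Rightarrow> nat \<Rightarrow> 'a \<Rightarrow> bool" where
  "clock_at s k \<omega> \<longleftrightarrow> arrival E k \<omega> \<le> s \<and> s < arrival E (Suc k) \<omega>"

lemma clock_at_measurable [measurable]: "Measurable.pred M (clock_at s k)"
  unfolding clock_at_def by measurable

text \<open>The Poisson weight is the difference of two consecutive Erlang distribution functions;
  the events are nested almost surely.\<close>

lemma prob_clock_at:
  assumes "0 \<le> s"
  shows "prob {\<omega> \<in> space M. clock_at s k \<omega>} = s ^ k * exp (- s) / fact k"
proof -
  let ?A = "\<lambda>k. {\<omega> \<in> space M. arrival E k \<omega> \<le> s}"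
  have "prob {\<omega> \<in> space M. clock_at s k \<omega>} = prob (?A k - ?A (Suc k))"
    by (intro arg_cong[where f=prob]) (auto simp: clock_at_def)
  also have "\<dots> = prob (?A k) - prob (?A k \<inter> ?A (Suc k))"
    by (intro finite_measure_Diff') measurable
  also have "prob (?A k \<inter> ?A (Suc k)) = prob (?A (Suc k))"
  proof (rule finite_measure_eq_AE)
    show "AE \<omega> in M. \<omega> \<in> ?A k \<inter> ?A (Suc k) \<longleftrightarrow> \<omega> \<in> ?A (Suc k)"
      using AE_E_nonneg
    proof eventually_elim
      case (elim \<omega>)
      then have "arrival E k \<omega> \<le> arrival E (Suc k) \<omega>"
        by (intro arrival_mono) auto
      then show ?case by auto
    qed
  qed measurable
  finally show ?thesis
    by (simp add: prob_arrival_le[OF assms])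
qed

lemma clock_at_unique:
  assumes "\<And>j. 0 \<le> E j \<omega>" "clock_at s k \<omega>" "clock_at s l \<omega>"
  shows "k = l"
  using poisson_count_eq[of E \<omega> k s] poisson_count_eq[of E \<omega> l s] assms
  by (simp add: clock_at_def)

lemma sums_prob_clock_at:
  assumes [measurable]: "\<And>k. Measurable.pred M (P k)"
  shows "(\<lambda>k. prob {\<omega> \<in> space M. clock_at s k \<omega> \<and> P k \<omega>}) sums
    prob {\<omega> \<in> space M. \<exists>k. clock_at s k \<omega> \<and> P k \<omega>}"
proof -
  \<comment> \<open>Disjointness needs nonnegative interarrival times, which hold only almost
    surely, so they are built into the events and removed again afterwards.\<close>
  let ?A = "\<lambda>k. {\<omega> \<in> space M. (\<forall>j. 0 \<le> E j \<omega>) \<and> clock_at s k \<omega> \<and> P k \<omega>}"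
  have "(\<lambda>k. prob (?A k)) sums prob (\<Union>k. ?A k)"
  proof (rule finite_measure_UNION)
    show "disjoint_family ?A"
      using clock_at_unique by (fastforce simp: disjoint_family_on_def)
  qed auto
  also have "(\<lambda>k. prob (?A k)) = (\<lambda>k. prob {\<omega> \<in> space M. clock_at s k \<omega> \<and> P k \<omega>})"
    using AE_E_nonneg by (intro ext finite_measure_eq_AE) (auto elim!: eventually_mono)
  also have "prob (\<Union>k. ?A k) = prob {\<omega> \<in> space M. \<exists>k. clock_at s k \<omega> \<and> P k \<omega>}"
    using AE_E_nonneg by (intro finite_measure_eq_AE) (auto elim!: eventually_mono)
  finally show ?thesis .
qed

text \<open>The Poisson weights sum to 1, so almost surely only finitely many arcs arrive by time
  \<open>s\<close>.\<close>

lemma AE_clock_at: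
  assumes "0 \<le> s"
  shows "AE \<omega> in M. \<exists>k. clock_at s k \<omega>"
proof -
  have "(\<lambda>k. s ^ k * exp (- s) / fact k) sums prob {\<omega> \<in> space M. \<exists>k. clock_at s k \<omega>}"
    using sums_prob_clock_at[of "\<lambda>_ _. True" s] by (simp add: prob_clock_at[OF assms])
  moreover have "(\<lambda>k. s ^ k * exp (- s) / fact k) sums (exp s * exp (- s))"
    using sums_mult2[OF exp_converges[of s], of "exp (- s)"] by (simp add: field_simps)
  ultimately have "prob {\<omega> \<in> space M. \<exists>k. clock_at s k \<omega>} = 1"
    by (simp add: sums_iff flip: exp_add)
  then show ?thesis
    by (subst (asm) prob_Collect_eq_1) auto
qed

section \<open>Independence between arcs and of arcs from the clock\<close>

lemma prob_pairs:
  "prob {\<omega> \<in> space M. \<forall>j<k. H (R j \<omega>) (U j \<omega>)} =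
    (\<Prod>j<k. prob {\<omega> \<in> space M. H (R j \<omega>) (U j \<omega>)})"
proof (cases "k = 0")
  case True
  then show ?thesis by (simp add: prob_space)
next
  case False
  \<comment> \<open>The length and the starting point of arc \<open>j\<close> form one block of
    coordinates; disjoint blocks are independent. The existentials in \<open>?A\<close> read natural
    numbers back from real coordinates.\<close>
  let ?K = "\<lambda>j. {Inl j, Inr (Inl j)} :: (nat + nat + nat) set"
  let ?X = "\<lambda>j \<omega>. restrict (\<lambda>i. driving_family R U E i \<omega>) (?K j)"
  let ?A = "\<lambda>j. {x \<in> space (PiM (?K j) (\<lambda>_. borel)).
    \<exists>r u. x (Inl j) = real r \<and> x (Inr (Inl j)) = real u \<and> H r u}"
  have eq: "?X j -` ?A j \<inter> space M = {\<omega> \<in> space M. H (R j \<omega>) (U j \<omega>)}" for j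
    by (auto simp: driving_family_def space_PiM)
  have "indep_vars (\<lambda>j. PiM (?K j) (\<lambda>_. borel)) ?X UNIV"
    by (rule indep_vars_restrict[OF indep]) (auto simp: disjoint_family_on_def)
  then have "prob (\<Inter>j\<in>{..<k}. ?X j -` ?A j \<inter> space M) = (\<Prod>j<k. prob (?X j -` ?A j \<inter> space M))"
    using False by (intro indep_varsD) auto
  moreover have "(\<Inter>j\<in>{..<k}. ?X j -` ?A j \<inter> space M) = {\<omega> \<in> space M. \<forall>j<k. H (R j \<omega>) (U j \<omega>)}"
    unfolding eq using False by auto
  ultimately show ?thesis
    unfolding eq by simp
qed

lemma prob_pair:
  "prob {\<omega> \<in> space M. P (R j \<omega>) \<and> U j \<omega> = u} =
    prob {\<omega> \<in> space M. P (R j \<omega>)} * prob {\<omega> \<in> space M. U j \<omega> = u}"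
proof -
  let ?A = "\<lambda>i. case i of Inl _ \<Rightarrow> real ` {r. P r} | Inr _ \<Rightarrow> {real u}"
  let ?Y = "\<lambda>i. driving_family R U E i -` ?A i \<inter> space M"
  have sets_A: "?A i \<in> sets borel" for i :: "nat + nat + nat"
    by (rule sets.countable) (auto split: sum.split)
  have Y: "?Y (Inl j) = {\<omega> \<in> space M. P (R j \<omega>)}"
    "?Y (Inr (Inl j)) = {\<omega> \<in> space M. U j \<omega> = u}"
    by (auto simp: driving_family_def)
  have "prob (\<Inter>i\<in>{Inl j, Inr (Inl j)}. ?Y i) = (\<Prod>i\<in>{Inl j, Inr (Inl j)}. prob (?Y i))"
    by (rule indep_varsD[OF indep _ _ _ sets_A]) simp_all
  moreover have "(\<Inter>i\<in>{Inl j, Inr (Inl j)}. ?Y i) = ?Y (Inl j) \<inter> ?Y (Inr (Inl j))"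
    by simp
  moreover have "(\<Prod>i\<in>{Inl j, Inr (Inl j)}. prob (?Y i)) = prob (?Y (Inl j)) * prob (?Y (Inr (Inl j)))"
    by simp
  ultimately show ?thesis
    unfolding Y by (simp add: Int_def conj_ac)
qed

definition prob_covered :: "nat \<Rightarrow> real" where
  "prob_covered k = prob {\<omega> \<in> space M. covered_set n R U k \<omega> = {0..<n}}"

text \<open>The clock uses only the interarrival coordinates \<open>?K1\<close>, the covered set
  only the complementary ones, so the two events are independent.\<close>

lemma prob_clock_at_covered:
  assumes "0 \<le> s"
  shows "prob {\<omega> \<in> space M. clock_at s k \<omega> \<and> covered_set n R U k \<omega> = {0..<n}} =
    s ^ k * exp (- s) / fact k * prob_covered k"
proof -
  let ?K1 = "{i. case i of Inr (Inr j) \<Rightarrow> True | _ \<Rightarrow> False} :: (nat + nat + nat) set"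
  let ?M = "\<lambda>K. PiM K (\<lambda>_::nat + nat + nat. borel :: real measure)"
  let ?X = "\<lambda>K \<omega>. restrict (\<lambda>i. driving_family R U E i \<omega>) K"
  let ?A = "{x \<in> space (?M ?K1). (\<Sum>j<k. x (Inr (Inr j))) \<le> s \<and> s < (\<Sum>j<Suc k. x (Inr (Inr j)))}"
  let ?B = "{x \<in> space (?M (- ?K1)). \<forall>y. (\<exists>j<k. \<exists>r u. x (Inl j) = real r \<and>
    x (Inr (Inl j)) = real u \<and> y \<in> arc n u r) \<longleftrightarrow> y < n}"
  have [measurable]: "(\<lambda>x. x (Inr (Inr j))) \<in> borel_measurable (?M ?K1)" for j
    by (rule measurable_component_singleton) simp
  have [measurable]: "(\<lambda>x. x (Inl j)) \<in> borel_measurable (?M (- ?K1))"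
    "(\<lambda>x. x (Inr (Inl j))) \<in> borel_measurable (?M (- ?K1))" for j
    by (rule measurable_component_singleton, simp)+
  have A: "?A \<in> sets (?M ?K1)" by measurable
  have B: "?B \<in> sets (?M (- ?K1))" by measurable
  have A_eq: "?X ?K1 -` ?A \<inter> space M = {\<omega> \<in> space M. clock_at s k \<omega>}"
    by (auto simp: clock_at_def arrival_def driving_family_def space_PiM)
  have B_eq: "?X (- ?K1) -` ?B \<inter> space M = {\<omega> \<in> space M. covered_set n R U k \<omega> = {0..<n}}"
    by (auto simp: covered_set_def driving_family_def space_PiM set_eq_iff)
  have "indep_var (?M ?K1) (?X ?K1) (?M (- ?K1)) (?X (- ?K1))"
    by (rule indep_var_restrict[OF indep]) auto
  note indep_varD[OF this A B, unfolded A_eq B_eq]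
  moreover have "(\<lambda>\<omega>. (?X ?K1 \<omega>, ?X (- ?K1) \<omega>)) -` (?A \<times> ?B) \<inter> space M =
      (?X ?K1 -` ?A \<inter> space M) \<inter> (?X (- ?K1) -` ?B \<inter> space M)"
    by blast
  moreover have "\<dots> = {\<omega> \<in> space M. clock_at s k \<omega> \<and> covered_set n R U k \<omega> = {0..<n}}"
    unfolding A_eq B_eq by blast
  ultimately show ?thesis
    unfolding prob_covered_def prob_clock_at[OF assms, symmetric] by (simp only:)
qed

section \<open>Bounds on the probability that \<open>k\<close> arcs cover\<close>

lemma prob_covered_ge: "1 - (1 - radius_tail Rd (real n)) ^ k \<le> prob_covered k"
proof -
  \<comment> \<open>All \<open>k\<close> arcs are shorter than \<open>n\<close>; outside this event
    a single arc already covers the circle.\<close>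
  let ?N = "{\<omega> \<in> space M. \<forall>j<k. R j \<omega> < n}"
  have "prob {\<omega> \<in> space M. R j \<omega> < n} = 1 - radius_tail Rd (real n)" for j
  proof -
    have "prob {\<omega> \<in> space M. R j \<omega> < n} = measure_pmf.prob Rd (UNIV - {r. real n \<le> real r})"
      unfolding prob_R[of "\<lambda>r. r < n"] by (intro arg_cong[where f="measure_pmf.prob Rd"]) auto
    then show ?thesis
      by (simp add: measure_pmf.prob_compl[of _ Rd, simplified] radius_tail_def)
  qed
  then have "1 - (1 - radius_tail Rd (real n)) ^ k = 1 - prob ?N"
    using prob_pairs[of k "\<lambda>r u. r < n"] by simp
  also have "\<dots> = prob (space M - ?N)"
    by (rule prob_compl[symmetric]) measurable
  also have "\<dots> \<le> prob_covered k"
    unfolding prob_covered_def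
  proof (rule finite_measure_mono)
    show "space M - ?N \<subseteq> {\<omega> \<in> space M. covered_set n R U k \<omega> = {0..<n}}"
    proof
      fix \<omega> assume \<omega>: "\<omega> \<in> space M - ?N"
      then obtain j where j: "j < k" "n \<le> R j \<omega>" by (auto simp: not_less)
      then have "{0..<n} \<subseteq> covered_set n R U k \<omega>"
        using arc_full[OF n_pos j(2), of "U j \<omega>"] unfolding covered_set_def by blast
      with \<omega> covered_set_subset[OF n_pos, of R U k \<omega>]
      show "\<omega> \<in> {\<omega> \<in> space M. covered_set n R U k \<omega> = {0..<n}}"
        by auto
    qed
  qed measurable
  finally show ?thesis .
qed

text \<open>\<^prop>\<open>0 \<in> arc n u r\<close> forces \<open>r \<ge> v + 1\<close>, where \<open>v = - u\<close> modulo \<open>n\<close> is again uniform.\<close>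
lemma prob_zero_in_arc_le:
  "prob {\<omega> \<in> space M. 0 \<in> arc n (U j \<omega>) (R j \<omega>)} \<le> (\<Sum>r=1..n. radius_tail Rd (real r)) / real n"
proof -
  have U_lt: "AE \<omega> in M. U j \<omega> < n"
  proof -
    have "prob {\<omega> \<in> space M. U j \<omega> < n} = 1"
      unfolding prob_U[of "\<lambda>u. u < n"] using n_pos
      by (simp add: measure_pmf_of_set Int_absorb2 subset_iff)
    then show ?thesis by (subst (asm) prob_Collect_eq_1) auto
  qed
  have "prob {\<omega> \<in> space M. 0 \<in> arc n (U j \<omega>) (R j \<omega>)} \<le>
      prob (\<Union>u\<in>{0..<n}. {\<omega> \<in> space M. (n - u) mod n + 1 \<le> R j \<omega> \<and> U j \<omega> = u})"
  proof (rule finite_measure_mono_AE)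
    show "AE \<omega> in M. \<omega> \<in> {\<omega> \<in> space M. 0 \<in> arc n (U j \<omega>) (R j \<omega>)} \<longrightarrow>
        \<omega> \<in> (\<Union>u\<in>{0..<n}. {\<omega> \<in> space M. (n - u) mod n + 1 \<le> R j \<omega> \<and> U j \<omega> = u})"
      using U_lt
    proof eventually_elim
      case (elim \<omega>)
      then show ?case using zero_in_arcD[of "U j \<omega>" n "R j \<omega>"] by auto
    qed
  qed measurable
  also have "\<dots> \<le> (\<Sum>u\<in>{0..<n}. prob {\<omega> \<in> space M. (n - u) mod n + 1 \<le> R j \<omega> \<and> U j \<omega> = u})"
    by (rule finite_measure_subadditive_finite) auto
  also have "\<dots> = (\<Sum>u\<in>{0..<n}. radius_tail Rd (real ((n - u) mod n + 1)) / real n)"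
  proof (rule sum.cong[OF refl])
    fix u assume u: "u \<in> {0..<n}"
    have "prob {\<omega> \<in> space M. U j \<omega> = u} = 1 / real n"
      unfolding prob_U[of "\<lambda>v. v = u"] using u by (simp add: measure_pmf_of_set)
    moreover have "prob {\<omega> \<in> space M. (n - u) mod n + 1 \<le> R j \<omega>} =
        radius_tail Rd (real ((n - u) mod n + 1))"
      unfolding prob_R radius_tail_def of_nat_le_iff ..
    ultimately show "prob {\<omega> \<in> space M. (n - u) mod n + 1 \<le> R j \<omega> \<and> U j \<omega> = u} =
        radius_tail Rd (real ((n - u) mod n + 1)) / real n"
      by (simp add: prob_pair)
  qed
  also have "\<dots> = (\<Sum>r=1..n. radius_tail Rd (real r) / real n)"
  \<comment> \<open>Negation modulo \<open>n\<close> is an involution on the residues; the shift by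
    1 turns residues into the lengths 1 to \<open>n\<close>.\<close>
  proof (rule sum.reindex_bij_witness[where j="\<lambda>u. (n - u) mod n + 1" and i="\<lambda>r. (n - (r - 1)) mod n"])
    fix u assume "u \<in> {0..<n}"
    then show "(n - ((n - u) mod n + 1 - 1)) mod n = u" "(n - u) mod n + 1 \<in> {1..n}"
      by (cases "u = 0"; auto simp: Suc_le_eq)+
  next
    fix r assume "r \<in> {1..n}"
    then show "(n - (n - (r - 1)) mod n) mod n + 1 = r" "(n - (r - 1)) mod n \<in> {0..<n}"
      by (cases "r = 1"; auto)+
  qed simp
  finally show ?thesis
    by (simp add: sum_divide_distrib)
qed

text \<open>Keeps the factors 1 - Q nonnegative when \<open>prob_covered_le\<close> compares
  products.\<close>

lemma mean_radius_tail_le_1: "(\<Sum>r=1..n. radius_tail Rd (real r)) / real n \<le> 1"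
  using n_pos sum_bounded_above[of "{1..n}" "\<lambda>r. radius_tail Rd (real r)" 1]
  by (simp add: radius_tail_def)

lemma prob_covered_le:
  "prob_covered k \<le> 1 - (1 - (\<Sum>r=1..n. radius_tail Rd (real r)) / real n) ^ k"
proof -
  define Q where "Q = (\<Sum>r=1..n. radius_tail Rd (real r)) / real n"
  \<comment> \<open>All \<open>k\<close> arcs miss the point 0. Independence and the one-arc bound
    give this event probability at least (1 - Q)^k.\<close>
  let ?N = "{\<omega> \<in> space M. \<forall>j<k. 0 \<notin> arc n (U j \<omega>) (R j \<omega>)}"
  have "1 - Q \<le> prob {\<omega> \<in> space M. 0 \<notin> arc n (U j \<omega>) (R j \<omega>)}" for j
    using prob_zero_in_arc_le[of j, folded Q_def] by (subst prob_neg) auto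
  then have "(\<Prod>j<k. 1 - Q) \<le> (\<Prod>j<k. prob {\<omega> \<in> space M. 0 \<notin> arc n (U j \<omega>) (R j \<omega>)})"
    using mean_radius_tail_le_1[folded Q_def] by (intro prod_mono) auto
  then have "(1 - Q) ^ k \<le> prob ?N"
    using prob_pairs[of k "\<lambda>r u. 0 \<notin> arc n u r"] by simp
  moreover have "prob_covered k \<le> prob (space M - ?N)"
    unfolding prob_covered_def
  proof (rule finite_measure_mono)
    show "{\<omega> \<in> space M. covered_set n R U k \<omega> = {0..<n}} \<subseteq> space M - ?N"
    proof safe
      fix \<omega> assume *: "covered_set n R U k \<omega> = {0..<n}" "\<forall>j<k. 0 \<notin> arc n (U j \<omega>) (R j \<omega>)"
      have "0 \<in> covered_set n R U k \<omega>" unfolding *(1) using n_pos by simp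
      with *(2) show False by (auto simp: covered_set_def)
    qed
  qed measurable
  moreover have "prob (space M - ?N) = 1 - prob ?N"
    by (rule prob_compl) measurable
  ultimately show ?thesis
    unfolding Q_def by simp
qed

section \<open>From a fixed number of arcs to the cover time\<close>

lemma AE_covered:
  assumes "0 < radius_tail Rd (real n)"
  shows "AE \<omega> in M. \<exists>k. covered_set n R U k \<omega> = {0..<n}"
proof -
  let ?C = "{\<omega> \<in> space M. \<exists>k. covered_set n R U k \<omega> = {0..<n}}"
  \<comment> \<open>The lower bound for \<open>k\<close> arcs tends to 1 as \<open>k\<close> grows,
    while \<open>?C\<close> does not depend on \<open>k\<close>.\<close>
  have "1 - (1 - radius_tail Rd (real n)) ^ k \<le> prob ?C" for k
    using prob_covered_ge[of k] unfolding prob_covered_def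
    by (rule order_trans) (intro finite_measure_mono, auto)
  moreover have "(\<lambda>k. 1 - (1 - radius_tail Rd (real n)) ^ k) \<longlonglongrightarrow> 1 - 0"
    using assms radius_tail_def[of Rd "real n"]
    by (intro tendsto_intros LIMSEQ_power_zero) auto
  ultimately have "1 \<le> prob ?C"
    by (intro LIMSEQ_le_const2[of _ 1 "prob ?C"]) auto
  then have "prob ?C = 1"
    using prob_le_1[of ?C] by simp
  then show ?thesis by (subst (asm) prob_Collect_eq_1) auto
qed

text \<open>Excludes the default value of the infimum. Integer times suffice as witnesses, so only
  countably many null sets are discarded.\<close>

lemma AE_cover_time_finite:
  assumes "0 < radius_tail Rd (real n)"
  shows "AE \<omega> in M. {t. 0 \<le> t \<and> covered_set n R U (poisson_count E t \<omega>) \<omega> = {0..<n}} \<noteq> {}"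
proof -
  have "AE \<omega> in M. \<forall>m. \<exists>k. clock_at (real m) k \<omega>"
    unfolding AE_all_countable by (intro allI AE_clock_at) simp
  then show ?thesis
    using AE_covered[OF assms] AE_E_nonneg
  proof eventually_elim
    case (elim \<omega>)
    from elim(2) obtain j where j: "covered_set n R U j \<omega> = {0..<n}" by blast
    obtain m :: nat where m: "arrival E j \<omega> \<le> real m" using real_arch_simple by blast
    from elim(1) obtain k where k: "clock_at (real m) k \<omega>" by blast
    have "\<not> Suc k \<le> j"
      using arrival_mono[of E \<omega> "Suc k" j] elim(3) k m by (force simp: clock_at_def)
    then have "covered_set n R U k \<omega> = {0..<n}"
      using covered_set_full_mono[OF n_pos _ j, of k] by simp
    moreover have "poisson_count E (real m) \<omega> = k"
      using k elim(3) by (intro poisson_count_eq) (auto simp: clock_at_def)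
    ultimately show ?case
      by (auto intro!: exI[of _ "real m"])
  qed
qed

lemma cover_time_le_iff:
  assumes nonneg: "\<And>j. 0 \<le> E j \<omega>" and "0 \<le> s" and k: "clock_at s k \<omega>"
    and ne: "{t. 0 \<le> t \<and> covered_set n R U (poisson_count E t \<omega>) \<omega> = {0..<n}} \<noteq> {}" (is "?B \<noteq> {}")
  shows "cover_time n R U E \<omega> \<le> s \<longleftrightarrow> covered_set n R U k \<omega> = {0..<n}"
proof
  assume "covered_set n R U k \<omega> = {0..<n}"
  moreover have "poisson_count E s \<omega> = k"
    using k nonneg by (intro poisson_count_eq) (auto simp: clock_at_def)
  ultimately have "s \<in> ?B" using \<open>0 \<le> s\<close> by simp
  moreover have "bdd_below ?B" by (rule bdd_belowI[of _ 0]) simp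
  ultimately show "cover_time n R U E \<omega> \<le> s"
    unfolding cover_time_def by (rule cInf_lower)
next
  assume le: "cover_time n R U E \<omega> \<le> s"
  show "covered_set n R U k \<omega> = {0..<n}"
  proof (rule ccontr)
    assume not: "covered_set n R U k \<omega> \<noteq> {0..<n}"
    \<comment> \<open>Before arrival \<open>Suc k\<close> at most \<open>k\<close> arcs have landed,
      and these do not cover. Hence the infimum lies strictly beyond \<open>s\<close>.\<close>
    have "arrival E (Suc k) \<omega> \<le> cover_time n R U E \<omega>"
      unfolding cover_time_def
    proof (rule cInf_greatest[OF ne], rule ccontr)
      fix t assume t: "t \<in> ?B" "\<not> arrival E (Suc k) \<omega> \<le> t"
      then have "poisson_count E t \<omega> \<le> k"
        using nonneg by (intro poisson_count_le) auto
      from covered_set_full_mono[OF n_pos this, of R U \<omega>] t(1) not show False by simp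
    qed
    with le k show False by (simp add: clock_at_def)
  qed
qed

lemma cover_time_measurable' [measurable]: "cover_time n R U E \<in> borel_measurable M"
  by (rule cover_time_measurable[OF n_pos]) measurable

text \<open>Decomposes by the number of arcs landed by time \<open>s\<close>; independence splits
  each term into a Poisson weight and \<open>prob_covered\<close>.\<close>

lemma cover_time_sums:
  assumes pos: "0 < radius_tail Rd (real n)" and "0 \<le> s"
  shows "(\<lambda>k. s ^ k * exp (- s) / fact k * prob_covered k) sums
    prob {\<omega> \<in> space M. cover_time n R U E \<omega> \<le> s}"
proof -
  have "prob {\<omega> \<in> space M. \<exists>k. clock_at s k \<omega> \<and> covered_set n R U k \<omega> = {0..<n}} =
      prob {\<omega> \<in> space M. cover_time n R U E \<omega> \<le> s}"
  proof (rule finite_measure_eq_AE)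
    show "AE \<omega> in M. \<omega> \<in> {\<omega> \<in> space M. \<exists>k. clock_at s k \<omega> \<and> covered_set n R U k \<omega> = {0..<n}}
        \<longleftrightarrow> \<omega> \<in> {\<omega> \<in> space M. cover_time n R U E \<omega> \<le> s}"
      using AE_E_nonneg AE_cover_time_finite[OF pos] AE_clock_at[OF \<open>0 \<le> s\<close>]
    proof eventually_elim
      case (elim \<omega>)
      then show ?case
        using cover_time_le_iff[of \<omega> s] \<open>0 \<le> s\<close> by auto
    qed
  qed measurable
  moreover have "(\<lambda>k. prob {\<omega> \<in> space M. clock_at s k \<omega> \<and> covered_set n R U k \<omega> = {0..<n}}) sums
      prob {\<omega> \<in> space M. \<exists>k. clock_at s k \<omega> \<and> covered_set n R U k \<omega> = {0..<n}}"
    by (rule sums_prob_clock_at) measurable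
  ultimately show ?thesis
    by (simp add: prob_clock_at_covered[OF \<open>0 \<le> s\<close>])
qed

text \<open>Termwise comparison of \<open>cover_time_sums\<close> with the two thinned
  series.\<close>

lemma cover_time_bounds:
  assumes pos: "0 < radius_tail Rd (real n)" and "0 \<le> s"
  shows "1 - exp (- s * radius_tail Rd (real n)) \<le> prob {\<omega> \<in> space M. cover_time n R U E \<omega> \<le> s}"
    and "prob {\<omega> \<in> space M. cover_time n R U E \<omega> \<le> s} \<le>
      1 - exp (- s * ((\<Sum>r=1..n. radius_tail Rd (real r)) / real n))"
  using prob_covered_ge prob_covered_le \<open>0 \<le> s\<close>
  by (intro sums_le[OF _ thinned_sums cover_time_sums[OF assms]]
      sums_le[OF _ cover_time_sums[OF assms] thinned_sums] mult_left_mono; simp)+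

lemma prob_cover_time_neg:
  assumes pos: "0 < radius_tail Rd (real n)" and "s < 0"
  shows "prob {\<omega> \<in> space M. cover_time n R U E \<omega> \<le> s} = 0"
proof -
  have "AE \<omega> in M. \<not> cover_time n R U E \<omega> \<le> s"
    using AE_cover_time_finite[OF pos]
  proof eventually_elim
    case (elim \<omega>)
    have "0 \<le> cover_time n R U E \<omega>"
      unfolding cover_time_def by (rule cInf_greatest[OF elim]) simp
    with \<open>s < 0\<close> show ?case by simp
  qed
  then show ?thesis
    by (subst prob_Collect_eq_0) auto
qed

end

subsection \<open>Weak convergence\<close>

theorem theoremD:
  fixes Rd :: "nat pmf"
    and M :: "nat \<Rightarrow> 'a measure"
    and R U :: "nat \<Rightarrow> nat \<Rightarrow> 'a \<Rightarrow> nat"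
    and E :: "nat \<Rightarrow> nat \<Rightarrow> 'a \<Rightarrow> real"
  assumes R_pos: "set_pmf Rd \<subseteq> {1..}"
    and sv: "slowly_varying (radius_tail Rd)"
    and prob: "\<And>n. 1 \<le> n \<Longrightarrow> prob_space (M n)"
    and indep: "\<And>n. 1 \<le> n \<Longrightarrow>
        prob_space.indep_vars (M n) (\<lambda>_. borel) (driving_family (R n) (U n) (E n)) UNIV"
    and R_law: "\<And>n k. 1 \<le> n \<Longrightarrow> distr (M n) (count_space UNIV) (R n k) = measure_pmf Rd"
    and U_law: "\<And>n k. 1 \<le> n \<Longrightarrow>
        distr (M n) (count_space UNIV) (U n k) = measure_pmf (pmf_of_set {0..<n})"
    and E_law: "\<And>n k. 1 \<le> n \<Longrightarrow> distributed (M n) lborel (E n k) (exponential_density 1)"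
  shows "weak_conv_m
           (\<lambda>n. distr (M n) borel (\<lambda>\<omega>. radius_tail Rd (real n) * cover_time n (R n) (U n) (E n) \<omega>))
           (density lborel (exponential_density 1))"
  unfolding weak_conv_m_def weak_conv_def
proof (intro allI impI)
  fix x :: real
  define f where "f n = radius_tail Rd (real n)" for n :: nat
  define Q where "Q n = (\<Sum>r=1..n. radius_tail Rd (real r)) / real n" for n :: nat
  define F where "F n = cdf (distr (M n) borel (\<lambda>\<omega>. radius_tail Rd (real n) * cover_time n (R n) (U n) (E n) \<omega>)) x" for n
  have pos: "0 < f n" for n
    unfolding f_def by (rule slowly_varying_antimono_pos[OF sv radius_tail_nonneg radius_tail_antimono])
  have cov: "arc_covering (M n) n Rd (R n) (U n) (E n)" if "1 \<le> n" for n
    using that prob indep R_law U_law E_law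
    by (intro arc_covering.intro arc_covering_axioms.intro)
  have F_eq: "F n = measure (M n) {\<omega> \<in> space (M n). cover_time n (R n) (U n) (E n) \<omega> \<le> x / f n}"
    if "1 \<le> n" for n
  proof -
    interpret arc_covering "M n" n Rd "R n" "U n" "E n" by (rule cov[OF that])
    show ?thesis
      unfolding F_def cdf_def using pos[of n]
      by (subst measure_distr) (auto simp: f_def field_simps intro!: arg_cong[where f="measure (M n)"])
  qed
  have exp_cdf: "cdf (density lborel (exponential_density 1)) x = (if 0 \<le> x then 1 - exp (- x) else 0)"
    using emeasure_erlang_density[of 1 0 x]
    by (simp add: cdf_def measure_def erlang_CDF_0)
  have "F \<longlonglongrightarrow> (if 0 \<le> x then 1 - exp (- x) else 0)"
  proof (cases "0 \<le> x")
    case True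
    \<comment> \<open>At time x / f(n) the lower bound no longer depends on \<open>n\<close>; only
      the upper bound needs a limit.\<close>
    have "eventually (\<lambda>n. 1 - exp (- x) \<le> F n) sequentially"
      using eventually_ge_at_top[of 1]
    proof eventually_elim
      case (elim n)
      from arc_covering.cover_time_bounds(1)[OF cov[OF elim], of "x / f n"] True pos[of n]
      show ?case by (simp add: F_eq[OF elim] flip: f_def)
    qed
    moreover have "eventually (\<lambda>n. F n \<le> 1 - exp (- x * (Q n / f n))) sequentially"
      using eventually_ge_at_top[of 1]
    proof eventually_elim
      case (elim n)
      from arc_covering.cover_time_bounds(2)[OF cov[OF elim], of "x / f n"] True pos[of n]
      show ?case by (simp add: F_eq[OF elim] Q_def mult.commute flip: f_def)
    qed
    moreover have "(\<lambda>n. Q n / f n) \<longlonglongrightarrow> 1"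
      using Karamata_antimono[OF sv radius_tail_nonneg radius_tail_antimono]
      by (simp add: Q_def f_def)
    then have "(\<lambda>n. 1 - exp (- x * (Q n / f n))) \<longlonglongrightarrow> 1 - exp (- x * 1)"
      by (intro tendsto_intros)
    ultimately have "F \<longlonglongrightarrow> 1 - exp (- x)"
      by (intro tendsto_sandwich[of "\<lambda>_. 1 - exp (- x)" F sequentially "\<lambda>n. 1 - exp (- x * (Q n / f n))"]) auto
    with True show ?thesis by simp
  next
    case False
    have "eventually (\<lambda>n. F n = 0) sequentially"
      using eventually_ge_at_top[of 1]
    proof eventually_elim
      case (elim n)
      from arc_covering.prob_cover_time_neg[OF cov[OF elim], of "x / f n"] False pos[of n]
      show ?case by (simp add: F_eq[OF elim] divide_less_0_iff flip: f_def)
    qed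
    with False show ?thesis by (simp add: tendsto_eventually)
  qed
  then show "(\<lambda>n. cdf (distr (M n) borel
        (\<lambda>\<omega>. radius_tail Rd (real n) * cover_time n (R n) (U n) (E n) \<omega>)) x)
      \<longlonglongrightarrow> cdf (density lborel (exponential_density 1)) x"
    unfolding exp_cdf F_def .
qed

end
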